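(* Let $E,F$ be complex Banach spaces, $U\subseteq E$ open, $v$ a weight on $U$, and $p\in[1,\infty)$. Let $f\in\mathcal H_v^\infty(U,F)$ and $g\in\mathcal H^\infty_{v\mathcal K_{wp}}(U,F^* )$. Assume that $(T_f)^*\in\Pi_p(F^*,\mathcal G_v^\infty(U)^* )$. Then $f^t\circ g\in\mathcal H^\infty_{v\mathcal K_p}(U,\mathcal H_v^\infty(U))$ with $$\|f^t\circ g\|_{\mathcal H^\infty_{v\mathcal K_p}}\le\pi_p((T_f)^* )\,\|g\|_{\mathcal H^\infty_{v\mathcal K_{wp}}}.$$
   Context: A weight on $U$ is a strictly positive continuous function. $\mathcal H_v^\infty(U,F)$ is the Banach space of holomorphic $f\colon U\to F$ with $\|f\|_v:=\sup_{x\in U}v(x)\|f(x)\|<\infty$; $\mathcal H_v^\infty(U):=\mathcal H_v^\infty(U,\mathbb C)$. The transpose of $f\in\mathcal H_v^\infty(U,F)$ is the bounded linear operator $f^t\colon F^*\to\mathcal H_v^\infty(U)$, $f^t(y^* )=y^*\circ f$. $p^*$ is the conjugate index of $p$. Linearization: $\mathcal G_v^\infty(U)$ is the closed subspace of $\mathcal H_v^\infty(U)^*$ consisting of all linear functionals on $\mathcal H_v^\infty(U)$ whose restriction to the closed unit ball of $\mathcal H_v^\infty(U)$ is continuous for the compact-open topology. $\Delta_v\colon U\to\mathcal G_v^\infty(U)$ is $\Delta_v(x)=\delta_x$, where $\delta_x(g)=g(x)$. For $f\in\mathcal H_v^\infty(U,F)$, $T_f\colon\mathcal G_v^\infty(U)\to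 F$ is the unique bounded linear operator with $T_f\circ\Delta_v=f$, and $(T_f)^*\colon F^*\to\mathcal G_v^\infty(U)^*$ is its adjoint. Sequences in a Banach space $X$: $\ell_p(X)$ is the space of sequences with $\|(x_n)\|_p=(\sum\|x_n\|^p)^{1/p}<\infty$; $\ell_p^w(X)$ of those with $\|(x_n)\|_p^w=\sup_{x^*\in B_{X^*}}(\sum|x^*(x_n)|^p)^{1/p}<\infty$. $p\text{-}\mathrm{conv}(x_n)=\{\sum_n a_nx_n:(a_n)\in B\}$, where $B=B_{\ell_{p^*}}$ if $1<p<\infty$ and $B=B_{c_0}$ if $p=1$. A set $K\subseteq X$ is relatively $p$-compact (resp. relatively weakly $p$-compact) if $K\subseteq p\text{-}\mathrm{conv}(x_n)$ for some $(x_n)$ in $\ell_p(X)$ (resp. $\ell_p^w(X)$); $m_{\mathcal K_p}(K)$ (resp. $m_{\mathcal K_{wp}}(K)$) is the infimum over all such sequences of $\|(x_n)\|_p$ (resp. $\|(x_n)\|_p^w$). For a complex Banach space $Y$ and $\mathcal I=\mathcal K_p$ (resp. $\mathcal K_{wp}$), $\mathcal H^\infty_{v\mathcal I}(U,Y)$ is the set of $h\in\mathcal H_v^\infty(U,Y)$ such that $(vh)(U)=\{v(x)h(x):x\in U\}$ is relatively $p$-compact (resp. relatively weakly $p$-compact), with $\|h\|_{\mathcal H^\infty_{v\mathcal I}}=m_{\mathcal I}((vh)(U))$. $\Pi_p(X,Y)$ is the space of $p$-summing operators $T\colon X\to Y$, i.e. those for which there is $C\ge0$ with $(\sum_{i=1}^n\|T(x_i)\|^p)^{1/p}\le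 C\sup_{x^*\in B_{X^*}}(\sum_{i=1}^n|x^*(x_i)|^p)^{1/p}$ for all finite families $x_1,\dots,x_n\in X$; $\pi_p(T)$ is the infimum of such $C$. *)

theory Defs
  imports "HOL-Analysis.Analysis" "HOL-Library.Function_Algebras"
begin

section \<open>Complex vector spaces and complex Banach spaces\<close>

class complex_vector = ab_group_add +
  fixes scaleC :: "complex \<Rightarrow> 'a \<Rightarrow> 'a"  (infixr \<open>*\<^sub>C\<close> 75)
  assumes scaleC_add_right: "a *\<^sub>C (x + y) = a *\<^sub>C x + a *\<^sub>C y"
    and scaleC_add_left: "(a + b) *\<^sub>C x = a *\<^sub>C x + b *\<^sub>C x"
    and scaleC_scaleC: "a *\<^sub>C (b *\<^sub>C x) = (a * b) *\<^sub>C x"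
    and scaleC_one: "1 *\<^sub>C x = x"

class complex_normed_vector = complex_vector + real_normed_vector +
  assumes scaleR_scaleC: "r *\<^sub>R x = complex_of_real r *\<^sub>C x"
    and norm_scaleC: "norm (a *\<^sub>C x) = cmod a * norm x"

class complex_banach = complex_normed_vector + complete_space

instantiation complex :: complex_banach
begin
definition scaleC_complex :: "complex \<Rightarrow> complex \<Rightarrow> complex" where
  "scaleC_complex a x = a * x"
instance
  by standard (auto simp: scaleC_complex_def algebra_simps norm_mult scaleR_conv_of_real)
end

instantiation "fun" :: (type, complex_vector) complex_vector
begin
definition scaleC_fun :: "complex \<Rightarrow> ('a \<Rightarrow> 'b) \<Rightarrow> 'a \<Rightarrow> 'b" where
  "scaleC_fun a f = (\<lambda>x. a *\<^sub>C f x)"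
instance
  by standard (auto simp: scaleC_fun_def fun_eq_iff scaleC_add_right scaleC_add_left
      scaleC_scaleC scaleC_one)
end


section \<open>Normed spaces given by a carrier\<close>

text \<open>
  The spaces of weighted holomorphic functions depend on the open set and on the weight, so they
  cannot be types. A normed space is represented by its set of vectors inside an ambient complex
  vector space together with its norm, which is only meaningful on that set. Functions defined on a
  subset (functionals on a carrier, holomorphic functions on an open set) are represented by total
  functions that vanish off the subset, so that the vector space operations are the pointwise ones.
\<close>

record 'a nspace =
  vecs :: "'a set"
  nrm :: "'a \<Rightarrow> real"

definition whole :: "'a::complex_normed_vector nspace" where
  "whole = \<lparr>vecs = UNIV, nrm = norm\<rparr>"

definition closed_unit_ball :: "'a nspace \<Rightarrow> 'a set" where
  "closed_unit_ball X = {x \<in> vecs X. nrm X x \<le> 1}"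

definition bounded_op ::
  "'a::complex_vector nspace \<Rightarrow> 'b::complex_vector nspace \<Rightarrow> ('a \<Rightarrow> 'b) \<Rightarrow> bool" where
  "bounded_op X Y T \<longleftrightarrow>
     (\<forall>x\<in>vecs X. T x \<in> vecs Y) \<and>
     (\<forall>x\<in>vecs X. \<forall>y\<in>vecs X. T (x + y) = T x + T y) \<and>
     (\<forall>a. \<forall>x\<in>vecs X. T (a *\<^sub>C x) = a *\<^sub>C T x) \<and>
     (\<exists>C. \<forall>x\<in>vecs X. nrm Y (T x) \<le> C * nrm X x)"

definition dual :: "'a::complex_vector nspace \<Rightarrow> ('a \<Rightarrow> complex) nspace" where
  "dual X = \<lparr>vecs = {\<phi>. bounded_op X whole \<phi> \<and> (\<forall>x. x \<notin> vecs X \<longrightarrow> \<phi> x = 0)},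
             nrm = (\<lambda>\<phi>. SUP x\<in>closed_unit_ball X. cmod (\<phi> x))\<rparr>"

definition adjoint_op ::
  "'a nspace \<Rightarrow> ('a \<Rightarrow> 'b) \<Rightarrow> ('b \<Rightarrow> complex) \<Rightarrow> ('a \<Rightarrow> complex)" where
  "adjoint_op X T y = (\<lambda>x. if x \<in> vecs X then y (T x) else 0)"


section \<open>Weighted holomorphic maps and linearization\<close>

definition weight :: "'e::topological_space set \<Rightarrow> ('e \<Rightarrow> real) \<Rightarrow> bool" where
  "weight U v \<longleftrightarrow> continuous_on U v \<and> (\<forall>x\<in>U. 0 < v x)"

text \<open>
  Holomorphic means complex Frechet differentiable at every point of the open set \<open>U\<close>.
\<close>

definition holomorphic_into ::
  "'e::complex_normed_vector set \<Rightarrow> 'b::complex_vector nspace \<Rightarrow> ('e \<Rightarrow> 'b) \<Rightarrow> bool" where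
  "holomorphic_into U Y h \<longleftrightarrow>
     (\<forall>x\<in>U. h x \<in> vecs Y) \<and>
     (\<forall>x\<in>U. \<exists>A. bounded_op whole Y A \<and>
        ((\<lambda>t. nrm Y (h (x + t) - h x - A t) / norm t) \<longlongrightarrow> 0) (at 0))"

lemma holomorphic_into_whole_iff:
  fixes h :: "'e::complex_normed_vector \<Rightarrow> 'f::complex_normed_vector"
  shows "holomorphic_into U whole h \<longleftrightarrow>
    (\<forall>x\<in>U. \<exists>A. (h has_derivative A) (at x) \<and> (\<forall>a t. A (a *\<^sub>C t) = a *\<^sub>C A t))"
proof -
  have op: "bounded_op whole whole A \<longleftrightarrow>
      bounded_linear A \<and> (\<forall>a t. A (a *\<^sub>C t) = a *\<^sub>C A t)" for A :: "'e \<Rightarrow> 'f"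
  proof
    assume A: "bounded_op whole whole A"
    then obtain C where C: "\<And>x. norm (A x) \<le> C * norm x"
      unfolding bounded_op_def whole_def by auto
    have "bounded_linear A"
      using A C unfolding bounded_op_def whole_def
      by (intro bounded_linear_intro[where K = C]) (auto simp: scaleR_scaleC mult.commute)
    with A show "bounded_linear A \<and> (\<forall>a t. A (a *\<^sub>C t) = a *\<^sub>C A t)"
      unfolding bounded_op_def whole_def by auto
  next
    assume "bounded_linear A \<and> (\<forall>a t. A (a *\<^sub>C t) = a *\<^sub>C A t)"
    then show "bounded_op whole whole A"
      unfolding bounded_op_def whole_def
      by (auto simp: linear_add bounded_linear.linear)
        (metis bounded_linear.bounded mult.commute)
  qed
  show ?thesis
    unfolding holomorphic_into_def op has_derivative_at
    by (auto simp: whole_def)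
qed

text \<open>
  Inserting \<open>0\<close> in the supremum matters only for \<open>U = {}\<close>, where the real \<open>Sup\<close> is unspecified.
\<close>

definition Hv :: "'e::complex_normed_vector set \<Rightarrow> ('e \<Rightarrow> real) \<Rightarrow> 'b::complex_vector nspace
    \<Rightarrow> ('e \<Rightarrow> 'b) nspace" where
  "Hv U v Y = \<lparr>vecs = {h. holomorphic_into U Y h \<and> (\<forall>x. x \<notin> U \<longrightarrow> h x = 0) \<and>
                        bdd_above ((\<lambda>x. v x * nrm Y (h x)) ` U)},
               nrm = (\<lambda>h. Sup (insert 0 ((\<lambda>x. v x * nrm Y (h x)) ` U)))\<rparr>"

abbreviation Hvc :: "'e::complex_normed_vector set \<Rightarrow> ('e \<Rightarrow> real) \<Rightarrow> ('e \<Rightarrow> complex) nspace" where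
  "Hvc U v \<equiv> Hv U v whole"

definition transpose_map :: "('e \<Rightarrow> 'f) \<Rightarrow> ('f \<Rightarrow> complex) \<Rightarrow> ('e \<Rightarrow> complex)" where
  "transpose_map f y = y \<circ> f"

definition compact_open_topology :: "'e::topological_space set \<Rightarrow> ('e \<Rightarrow> complex) topology" where
  "compact_open_topology U =
     topology_generated_by {{h. h ` K \<subseteq> V} | K V. compact K \<and> K \<subseteq> U \<and> open V}"

definition Gv :: "'e::complex_normed_vector set \<Rightarrow> ('e \<Rightarrow> real)
    \<Rightarrow> (('e \<Rightarrow> complex) \<Rightarrow> complex) nspace" where
  "Gv U v = \<lparr>vecs = {\<phi> \<in> vecs (dual (Hvc U v)).
               continuous_map (subtopology (compact_open_topology U) (closed_unit_ball (Hvc U v)))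
                 euclidean \<phi>},
             nrm = nrm (dual (Hvc U v))\<rparr>"

definition Delta :: "'e::complex_normed_vector set \<Rightarrow> ('e \<Rightarrow> real) \<Rightarrow> 'e
    \<Rightarrow> ('e \<Rightarrow> complex) \<Rightarrow> complex" where
  "Delta U v x = (\<lambda>h. if h \<in> vecs (Hvc U v) then h x else 0)"

text \<open>
  The operator \<open>T\<^sub>f\<close> is determined by the following property.
\<close>

definition is_linearization :: "'e::complex_normed_vector set \<Rightarrow> ('e \<Rightarrow> real)
    \<Rightarrow> ('e \<Rightarrow> 'f::complex_normed_vector) \<Rightarrow> ((('e \<Rightarrow> complex) \<Rightarrow> complex) \<Rightarrow> 'f) \<Rightarrow> bool" where
  "is_linearization U v f T \<longleftrightarrow>
     bounded_op (Gv U v) whole T \<and> (\<forall>x\<in>U. T (Delta U v x) = f x)"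


section \<open>Summable sequences and relatively (weakly) p-compact sets\<close>

definition lp_seqs :: "'a nspace \<Rightarrow> real \<Rightarrow> (nat \<Rightarrow> 'a) set" where
  "lp_seqs X p = {x. (\<forall>n. x n \<in> vecs X) \<and> summable (\<lambda>n. nrm X (x n) powr p)}"

definition lp_norm :: "'a nspace \<Rightarrow> real \<Rightarrow> (nat \<Rightarrow> 'a) \<Rightarrow> real" where
  "lp_norm X p x = (\<Sum>n. nrm X (x n) powr p) powr (1 / p)"

definition lpw_seqs :: "'a::complex_vector nspace \<Rightarrow> real \<Rightarrow> (nat \<Rightarrow> 'a) set" where
  "lpw_seqs X p = {x. (\<forall>n. x n \<in> vecs X) \<and>
     (\<forall>\<phi>\<in>closed_unit_ball (dual X). summable (\<lambda>n. cmod (\<phi> (x n)) powr p)) \<and>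
     bdd_above ((\<lambda>\<phi>. (\<Sum>n. cmod (\<phi> (x n)) powr p) powr (1 / p)) ` closed_unit_ball (dual X))}"

definition lpw_norm :: "'a::complex_vector nspace \<Rightarrow> real \<Rightarrow> (nat \<Rightarrow> 'a) \<Rightarrow> real" where
  "lpw_norm X p x =
     (SUP \<phi>\<in>closed_unit_ball (dual X). (\<Sum>n. cmod (\<phi> (x n)) powr p) powr (1 / p))"

definition conj_index :: "real \<Rightarrow> real" where
  "conj_index p = p / (p - 1)"

definition coeff_ball :: "real \<Rightarrow> (nat \<Rightarrow> complex) set" where
  "coeff_ball p =
     (if p = 1 then {a. a \<longlonglongrightarrow> 0 \<and> (\<forall>n. cmod (a n) \<le> 1)}
      else {a \<in> lp_seqs whole (conj_index p). lp_norm whole (conj_index p) a \<le> 1})"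

definition p_conv :: "'a::complex_vector nspace \<Rightarrow> real \<Rightarrow> (nat \<Rightarrow> 'a) \<Rightarrow> 'a set" where
  "p_conv X p x = {y \<in> vecs X. \<exists>a\<in>coeff_ball p.
     (\<lambda>N. nrm X ((\<Sum>n<N. a n *\<^sub>C x n) - y)) \<longlonglongrightarrow> 0}"

definition rel_p_compact :: "'a::complex_vector nspace \<Rightarrow> real \<Rightarrow> 'a set \<Rightarrow> bool" where
  "rel_p_compact X p K \<longleftrightarrow> (\<exists>x\<in>lp_seqs X p. K \<subseteq> p_conv X p x)"

definition m_Kp :: "'a::complex_vector nspace \<Rightarrow> real \<Rightarrow> 'a set \<Rightarrow> real" where
  "m_Kp X p K = Inf {lp_norm X p x | x. x \<in> lp_seqs X p \<and> K \<subseteq> p_conv X p x}"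

definition rel_weakly_p_compact :: "'a::complex_vector nspace \<Rightarrow> real \<Rightarrow> 'a set \<Rightarrow> bool" where
  "rel_weakly_p_compact X p K \<longleftrightarrow> (\<exists>x\<in>lpw_seqs X p. K \<subseteq> p_conv X p x)"

definition m_Kwp :: "'a::complex_vector nspace \<Rightarrow> real \<Rightarrow> 'a set \<Rightarrow> real" where
  "m_Kwp X p K = Inf {lpw_norm X p x | x. x \<in> lpw_seqs X p \<and> K \<subseteq> p_conv X p x}"

definition weighted_range ::
  "'e set \<Rightarrow> ('e \<Rightarrow> real) \<Rightarrow> ('e \<Rightarrow> 'b::complex_vector) \<Rightarrow> 'b set" where
  "weighted_range U v h = (\<lambda>x. complex_of_real (v x) *\<^sub>C h x) ` U"

definition Hv_Kp :: "'e::complex_normed_vector set \<Rightarrow> ('e \<Rightarrow> real) \<Rightarrow> 'b::complex_vector nspace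
    \<Rightarrow> real \<Rightarrow> ('e \<Rightarrow> 'b) nspace" where
  "Hv_Kp U v Y p = \<lparr>vecs = {h \<in> vecs (Hv U v Y). rel_p_compact Y p (weighted_range U v h)},
                    nrm = (\<lambda>h. m_Kp Y p (weighted_range U v h))\<rparr>"

definition Hv_Kwp :: "'e::complex_normed_vector set \<Rightarrow> ('e \<Rightarrow> real) \<Rightarrow> 'b::complex_vector nspace
    \<Rightarrow> real \<Rightarrow> ('e \<Rightarrow> 'b) nspace" where
  "Hv_Kwp U v Y p =
     \<lparr>vecs = {h \<in> vecs (Hv U v Y). rel_weakly_p_compact Y p (weighted_range U v h)},
      nrm = (\<lambda>h. m_Kwp Y p (weighted_range U v h))\<rparr>"


section \<open>p-summing operators\<close>

definition p_summing_bound :: "'a::complex_vector nspace \<Rightarrow> 'b nspace \<Rightarrow> real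
    \<Rightarrow> ('a \<Rightarrow> 'b) \<Rightarrow> real \<Rightarrow> bool" where
  "p_summing_bound X Y p T C \<longleftrightarrow> 0 \<le> C \<and>
     (\<forall>n. \<forall>x :: nat \<Rightarrow> 'a. (\<forall>i<n. x i \<in> vecs X) \<longrightarrow>
        (\<Sum>i<n. nrm Y (T (x i)) powr p) powr (1 / p)
        \<le> C * (SUP \<phi>\<in>closed_unit_ball (dual X). (\<Sum>i<n. cmod (\<phi> (x i)) powr p) powr (1 / p)))"

definition p_summing_ops :: "'a::complex_vector nspace \<Rightarrow> 'b::complex_vector nspace \<Rightarrow> real
    \<Rightarrow> ('a \<Rightarrow> 'b) set" where
  "p_summing_ops X Y p = {T. bounded_op X Y T \<and> (\<exists>C. p_summing_bound X Y p T C)}"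

definition pi_norm :: "'a::complex_vector nspace \<Rightarrow> 'b nspace \<Rightarrow> real \<Rightarrow> ('a \<Rightarrow> 'b) \<Rightarrow> real" where
  "pi_norm X Y p T = Inf {C. p_summing_bound X Y p T C}"

end

theory Submission
  imports Defs
begin

text \<open>
  For \<open>y\<close> in the dual of \<open>F\<close>, the number \<open>v x * y (f x)\<close> is the value of the functional
  \<open>(T\<^sub>f)\<^sup>* y\<close> at the point \<open>v x * \<delta>\<^sub>x\<close> of the unit ball of \<open>Gv U v\<close>; hence the norm of \<open>f\<^sup>t y\<close>
  is at most that of \<open>(T\<^sub>f)\<^sup>* y\<close>. A weakly \<open>p\<close>-summable sequence \<open>y\<^sub>n\<close> whose \<open>p\<close>-convex hull contains
  the weighted range of \<open>g\<close> is therefore mapped by \<open>f\<^sup>t\<close> to a \<open>p\<close>-summable sequence, with the constant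
  of \<open>(T\<^sub>f)\<^sup>*\<close>, and by linearity and continuity of \<open>f\<^sup>t\<close> its \<open>p\<close>-convex hull contains the weighted
  range of \<open>f\<^sup>t \<circ> g\<close>.
\<close>

section \<open>Operators and duals\<close>

lemma bounded_op_mem: "bounded_op X Y T \<Longrightarrow> x \<in> vecs X \<Longrightarrow> T x \<in> vecs Y"
  by (simp add: bounded_op_def)

lemma bounded_op_add:
  "bounded_op X Y T \<Longrightarrow> x \<in> vecs X \<Longrightarrow> y \<in> vecs X \<Longrightarrow> T (x + y) = T x + T y"
  by (simp add: bounded_op_def)

lemma bounded_op_scaleC: "bounded_op X Y T \<Longrightarrow> x \<in> vecs X \<Longrightarrow> T (a *\<^sub>C x) = a *\<^sub>C T x"
  by (simp add: bounded_op_def)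

lemma bounded_opE:
  assumes "bounded_op X Y T"
  obtains C where "\<And>x. x \<in> vecs X \<Longrightarrow> nrm Y (T x) \<le> C * nrm X x"
  using assms unfolding bounded_op_def by blast

lemma scaleC_fun_apply [simp]: "(a *\<^sub>C f) x = a *\<^sub>C f x"
  by (simp add: scaleC_fun_def)

lemma scaleC_zero_left [simp]: "0 *\<^sub>C x = (0 :: 'a :: complex_vector)"
  using scaleC_add_left[of 0 0 x] by simp

lemma scaleC_zero_right [simp]: "a *\<^sub>C 0 = (0 :: 'a :: complex_vector)"
  using scaleC_add_right[of a 0 0] by simp

lemma scaleC_minus_one: "(- 1) *\<^sub>C x = - (x :: 'a :: complex_vector)"
  using scaleC_add_left[of 1 "- 1" x] by (simp add: scaleC_one eq_neg_iff_add_eq_0 add.commute)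

lemma vecs_whole [simp]: "x \<in> vecs whole"
  and nrm_whole [simp]: "nrm whole = norm"
  by (simp_all add: whole_def)

lemma dual_bounded_op: "\<phi> \<in> vecs (dual X) \<Longrightarrow> bounded_op X whole \<phi>"
  by (simp add: dual_def)

text \<open>The dual norm is a real supremum, so it dominates its members only once the set is known
  to be bounded above; the operator bound supplies this. Nonnegativity of \<open>nrm X\<close> is a
  hypothesis because an \<open>nspace\<close> record carries no norm axioms.\<close>

lemma dual_le_nrm:
  assumes \<phi>: "\<phi> \<in> vecs (dual X)" and nonneg: "\<And>u. u \<in> vecs X \<Longrightarrow> 0 \<le> nrm X u"
    and x: "x \<in> closed_unit_ball X"
  shows "cmod (\<phi> x) \<le> nrm (dual X) \<phi>"
proof -
  obtain C where C: "\<And>u. u \<in> vecs X \<Longrightarrow> cmod (\<phi> u) \<le> C * nrm X u"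
    using bounded_opE[OF dual_bounded_op[OF \<phi>]] by auto
  have "cmod (\<phi> u) \<le> \<bar>C\<bar>" if "u \<in> closed_unit_ball X" for u
  proof -
    have u: "u \<in> vecs X" "nrm X u \<le> 1" using that by (auto simp: closed_unit_ball_def)
    have "cmod (\<phi> u) \<le> C * nrm X u" using C u by blast
    \<comment> \<open>\<open>bounded_op\<close> puts no sign on its constant, hence the absolute
      value.\<close>
    also have "\<dots> \<le> \<bar>C\<bar> * 1" using u nonneg[of u] by (intro mult_mono) auto
    finally show ?thesis by simp
  qed
  then have "bdd_above ((\<lambda>x. cmod (\<phi> x)) ` closed_unit_ball X)" by (auto intro!: bdd_aboveI2)
  then show ?thesis unfolding dual_def by (auto intro: cSUP_upper x)
qed

lemma nrm_dual_nonneg: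
  assumes "\<phi> \<in> vecs (dual X)" "\<And>u. u \<in> vecs X \<Longrightarrow> 0 \<le> nrm X u"
    and "closed_unit_ball X \<noteq> {}"
  shows "0 \<le> nrm (dual X) \<phi>"
proof -
  obtain x where "x \<in> closed_unit_ball X" using assms(3) by blast
  from order_trans[OF norm_ge_zero dual_le_nrm[OF assms(1,2) this]] show ?thesis .
qed

lemma nrm_dual_le:
  assumes "closed_unit_ball X \<noteq> {}" "\<And>x. x \<in> closed_unit_ball X \<Longrightarrow> cmod (\<phi> x) \<le> B"
  shows "nrm (dual X) \<phi> \<le> B"
  using assms by (auto simp: dual_def intro!: cSUP_least)

section \<open>Vector space operations on the dual\<close>

lemma dual_zero: "0 \<in> vecs (dual X)"
  by (auto simp: dual_def bounded_op_def intro!: exI[of _ 0])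

lemma dual_add:
  assumes "\<phi> \<in> vecs (dual X)" "\<psi> \<in> vecs (dual X)"
  shows "\<phi> + \<psi> \<in> vecs (dual X)"
proof -
  obtain C where C: "\<And>u. u \<in> vecs X \<Longrightarrow> cmod (\<phi> u) \<le> C * nrm X u"
    using bounded_opE[OF dual_bounded_op[OF assms(1)]] by auto
  obtain D where D: "\<And>u. u \<in> vecs X \<Longrightarrow> cmod (\<psi> u) \<le> D * nrm X u"
    using bounded_opE[OF dual_bounded_op[OF assms(2)]] by auto
  have "cmod (\<phi> u + \<psi> u) \<le> (C + D) * nrm X u" if "u \<in> vecs X" for u
    using norm_triangle_ineq[of "\<phi> u" "\<psi> u"] C[OF that] D[OF that] by (simp add: algebra_simps)
  then have "\<exists>C. \<forall>u\<in>vecs X. cmod (\<phi> u + \<psi> u) \<le> C * nrm X u" by blast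
  then show ?thesis
    using assms by (auto simp: dual_def bounded_op_def scaleC_add_right)
qed

lemma dual_scaleC:
  assumes "\<phi> \<in> vecs (dual X)"
  shows "a *\<^sub>C \<phi> \<in> vecs (dual X)"
proof -
  obtain C where C: "\<And>u. u \<in> vecs X \<Longrightarrow> cmod (\<phi> u) \<le> C * nrm X u"
    using bounded_opE[OF dual_bounded_op[OF assms]] by auto
  have "cmod (a * \<phi> u) \<le> (cmod a * C) * nrm X u" if "u \<in> vecs X" for u
    using mult_left_mono[OF C[OF that], of "cmod a"] by (simp add: norm_mult mult.assoc)
  then have "\<exists>D. \<forall>u\<in>vecs X. cmod (a * \<phi> u) \<le> D * nrm X u" by blast
  then show ?thesis
    using assms
    by (auto simp: dual_def bounded_op_def scaleC_complex_def distrib_left mult.left_commute)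
qed

lemma dual_diff:
  assumes "\<phi> \<in> vecs (dual X)" "\<psi> \<in> vecs (dual X)"
  shows "\<phi> - \<psi> \<in> vecs (dual X)"
  using dual_add[OF assms(1) dual_scaleC[OF assms(2), of "- 1"]] by (simp add: scaleC_minus_one)

lemma dual_sum:
  "finite I \<Longrightarrow> (\<And>i. i \<in> I \<Longrightarrow> \<phi> i \<in> vecs (dual X)) \<Longrightarrow> (\<Sum>i\<in>I. \<phi> i) \<in> vecs (dual X)"
  by (induction I rule: finite_induct) (auto simp: dual_zero dual_add)

section \<open>Functionals on a normed space given by a type\<close>

lemma dual_zero_apply:
  fixes \<phi> :: "'a::complex_normed_vector \<Rightarrow> complex"
  assumes "\<phi> \<in> vecs (dual whole)"
  shows "\<phi> 0 = 0"
  using bounded_op_scaleC[OF dual_bounded_op[OF assms], of 0 0] by simp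

lemma nrm_dual_whole_nonneg:
  "\<phi> \<in> vecs (dual whole) \<Longrightarrow> 0 \<le> nrm (dual (whole :: 'a::complex_normed_vector nspace)) \<phi>"
  by (rule nrm_dual_nonneg) (auto simp: closed_unit_ball_def intro: exI[of _ 0])

lemma dual_whole_le_nrm:
  fixes \<phi> :: "'a::complex_normed_vector \<Rightarrow> complex"
  assumes \<phi>: "\<phi> \<in> vecs (dual whole)"
  shows "cmod (\<phi> y) \<le> nrm (dual whole) \<phi> * norm y"
proof (cases "y = 0")
  case True
  then show ?thesis using dual_zero_apply[OF \<phi>] by simp
next
  case False
  \<comment> \<open>This scalar moves \<open>y\<close> to the unit sphere; homogeneity of
    \<open>\<phi>\<close> then undoes the scaling.\<close>
  define a where "a = complex_of_real (inverse (norm y))"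
  have "a *\<^sub>C y \<in> closed_unit_ball whole"
    using False by (simp add: closed_unit_ball_def norm_scaleC a_def norm_inverse)
  then have "cmod (\<phi> (a *\<^sub>C y)) \<le> nrm (dual whole) \<phi>" by (intro dual_le_nrm \<phi>) auto
  moreover have "\<phi> (a *\<^sub>C y) = a * \<phi> y"
    using bounded_op_scaleC[OF dual_bounded_op[OF \<phi>]] by (simp add: scaleC_complex_def)
  ultimately have "inverse (norm y) * cmod (\<phi> y) \<le> nrm (dual whole) \<phi>"
    by (simp add: a_def norm_mult norm_inverse)
  then show ?thesis using False by (simp add: field_simps)
qed

text \<open>Links the carrier-based dual to \<open>bounded_linear\<close>, so that the chain rule
  for \<open>has_derivative\<close> applies to \<open>y \<circ> f\<close>.\<close>

lemma dual_whole_bounded_linear: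
  fixes \<phi> :: "'a::complex_normed_vector \<Rightarrow> complex"
  assumes \<phi>: "\<phi> \<in> vecs (dual whole)"
  shows "bounded_linear \<phi>"
proof (rule bounded_linear_intro)
  show "\<phi> (x + y) = \<phi> x + \<phi> y" for x y
    using bounded_op_add[OF dual_bounded_op[OF \<phi>]] by simp
  show "\<phi> (r *\<^sub>R x) = r *\<^sub>R \<phi> x" for r x
    using bounded_op_scaleC[OF dual_bounded_op[OF \<phi>]] by (simp add: scaleR_scaleC)
  show "norm (\<phi> x) \<le> norm x * nrm (dual whole) \<phi>" for x
    using dual_whole_le_nrm[OF \<phi>] by (simp add: mult.commute)
qed

section \<open>Weighted holomorphic functions and the transpose\<close>

lemma Hv_mem: "h \<in> vecs (Hv U v Y) \<longleftrightarrow> holomorphic_into U Y h \<and> (\<forall>x. x \<notin> U \<longrightarrow> h x = 0) \<and>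
    bdd_above ((\<lambda>x. v x * nrm Y (h x)) ` U)"
  by (simp add: Hv_def)

lemma Hv_le_nrm: "h \<in> vecs (Hv U v Y) \<Longrightarrow> x \<in> U \<Longrightarrow> v x * nrm Y (h x) \<le> nrm (Hv U v Y) h"
  unfolding Hv_def by (auto intro!: cSup_upper)

lemma nrm_Hv_nonneg: "h \<in> vecs (Hv U v Y) \<Longrightarrow> 0 \<le> nrm (Hv U v Y) h"
  unfolding Hv_def by (auto intro!: cSup_upper)

lemma nrm_Hv_le:
  assumes "0 \<le> B" "\<And>x. x \<in> U \<Longrightarrow> v x * nrm Y (h x) \<le> B"
  shows "nrm (Hv U v Y) h \<le> B"
  using assms unfolding Hv_def by (auto intro!: cSup_least)

section \<open>The scalar space \<open>Hvc U v\<close> as a vector space\<close>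

lemma Hvc_zero: "0 \<in> vecs (Hvc U v)"
  by (auto simp: Hv_mem holomorphic_into_whole_iff zero_fun_def intro!: exI[of _ "\<lambda>_. 0"] bdd_aboveI2)

lemma zero_in_ball_Hvc: "0 \<in> closed_unit_ball (Hvc U v)"
  by (auto simp: closed_unit_ball_def Hvc_zero intro!: nrm_Hv_le)

text \<open>Closure under addition makes \<open>Delta\<close> additive: \<open>Delta\<close> is cut
  off to 0 outside the carrier, so sums must stay inside it.\<close>

lemma Hvc_add:
  assumes v: "weight U v" and h: "h \<in> vecs (Hvc U v)" and k: "k \<in> vecs (Hvc U v)"
  shows "h + k \<in> vecs (Hvc U v)"
proof -
  have "holomorphic_into U whole (h + k)"
    unfolding holomorphic_into_whole_iff
  proof
    fix x assume "x \<in> U"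
    then obtain A B where "(h has_derivative A) (at x)" "\<And>a t. A (a *\<^sub>C t) = a *\<^sub>C A t"
      "(k has_derivative B) (at x)" "\<And>a t. B (a *\<^sub>C t) = a *\<^sub>C B t"
      using h k by (fastforce simp: Hv_mem holomorphic_into_whole_iff)
    then show "\<exists>A. ((h + k) has_derivative A) (at x) \<and> (\<forall>a t. A (a *\<^sub>C t) = a *\<^sub>C A t)"
      by (intro exI[of _ "\<lambda>t. A t + B t"])
        (auto simp: plus_fun_def scaleC_add_right intro: has_derivative_add)
  qed
  moreover have "v x * cmod (h x + k x) \<le> nrm (Hvc U v) h + nrm (Hvc U v) k" if "x \<in> U" for x
  proof -
    have "v x * cmod (h x + k x) \<le> v x * (cmod (h x) + cmod (k x))"
      using v that by (intro mult_left_mono norm_triangle_ineq) (auto simp: weight_def less_imp_le)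
    then show ?thesis
      using Hv_le_nrm[OF h that] Hv_le_nrm[OF k that] by (simp add: algebra_simps)
  qed
  ultimately show ?thesis using h k by (auto simp: Hv_mem intro!: bdd_aboveI2)
qed

lemma Hvc_scaleC:
  assumes h: "h \<in> vecs (Hvc U v)"
  shows "a *\<^sub>C h \<in> vecs (Hvc U v)"
proof -
  have "holomorphic_into U whole (a *\<^sub>C h)"
    unfolding holomorphic_into_whole_iff
  proof
    fix x assume "x \<in> U"
    then obtain A where "(h has_derivative A) (at x)" "\<And>a t. A (a *\<^sub>C t) = a *\<^sub>C A t"
      using h by (fastforce simp: Hv_mem holomorphic_into_whole_iff)
    then show "\<exists>A. ((a *\<^sub>C h) has_derivative A) (at x) \<and> (\<forall>a t. A (a *\<^sub>C t) = a *\<^sub>C A t)"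
      by (intro exI[of _ "\<lambda>t. a * A t"])
        (auto simp: scaleC_fun_def scaleC_complex_def intro: has_derivative_mult_right)
  qed
  moreover have "v x * cmod (a * h x) \<le> cmod a * nrm (Hvc U v) h" if "x \<in> U" for x
    using mult_left_mono[OF Hv_le_nrm[OF h that], of "cmod a"] by (simp add: norm_mult algebra_simps)
  ultimately show ?thesis
    using h by (auto simp: Hv_mem scaleC_fun_def scaleC_complex_def intro!: bdd_aboveI2)
qed

text \<open>Pointwise, \<open>v x * cmod (y (f x))\<close> is at most the dual norm of
  \<open>y\<close> times \<open>v x * norm (f x)\<close>; holomorphy is the chain rule. This
  estimate provides continuity of the transpose, while the summing constant comes from the
  comparison with the adjoint.\<close>

lemma nrm_transpose_le:
  fixes f :: "'e::complex_normed_vector \<Rightarrow> 'f::complex_normed_vector"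
  assumes v: "weight U v" and f: "f \<in> vecs (Hv U v whole)" and y: "y \<in> vecs (dual whole)"
  shows "transpose_map f y \<in> vecs (Hvc U v)"
    and "nrm (Hvc U v) (transpose_map f y) \<le> nrm (Hv U v whole) f * nrm (dual whole) y"
proof -
  let ?B = "nrm (Hv U v whole) f * nrm (dual whole) y"
  have bound: "v x * cmod (y (f x)) \<le> ?B" if "x \<in> U" for x
  proof -
    have "v x * cmod (y (f x)) \<le> v x * (nrm (dual whole) y * norm (f x))"
      using v that by (intro mult_left_mono dual_whole_le_nrm y) (auto simp: weight_def less_imp_le)
    also have "\<dots> \<le> nrm (dual whole) y * nrm (Hv U v whole) f"
      using mult_left_mono[OF Hv_le_nrm[OF f that] nrm_dual_whole_nonneg[OF y]]
      by (simp add: algebra_simps)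
    finally show ?thesis by (simp add: mult.commute)
  qed
  have "holomorphic_into U whole (y \<circ> f)"
    unfolding holomorphic_into_whole_iff
  proof
    fix x assume "x \<in> U"
    then obtain A where A: "(f has_derivative A) (at x)" "\<And>a t. A (a *\<^sub>C t) = a *\<^sub>C A t"
      using f by (fastforce simp: Hv_mem holomorphic_into_whole_iff)
    have "((y \<circ> f) has_derivative (\<lambda>t. y (A t))) (at x)"
      using bounded_linear.has_derivative[OF dual_whole_bounded_linear[OF y] A(1)]
      by (simp add: comp_def)
    then show "\<exists>A. ((y \<circ> f) has_derivative A) (at x) \<and> (\<forall>a t. A (a *\<^sub>C t) = a *\<^sub>C A t)"
      using A(2) bounded_op_scaleC[OF dual_bounded_op[OF y]] by (intro exI[of _ "\<lambda>t. y (A t)"]) simp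
  qed
  \<comment> \<open>Off \<open>U\<close> the composition vanishes because \<open>f\<close> does and
    \<open>y 0 = 0\<close>.\<close>
  then show "transpose_map f y \<in> vecs (Hvc U v)"
    using f bound dual_zero_apply[OF y]
    by (auto simp: Hv_mem transpose_map_def intro!: bdd_aboveI2)
  show "nrm (Hvc U v) (transpose_map f y) \<le> ?B"
    using bound nrm_Hv_nonneg[OF f] nrm_dual_whole_nonneg[OF y]
    by (intro nrm_Hv_le) (auto simp: transpose_map_def)
qed

lemma transpose_zero [simp]: "transpose_map f 0 = 0"
  and transpose_add: "transpose_map f (y + z) = transpose_map f y + transpose_map f z"
  and transpose_diff: "transpose_map f (y - z) = transpose_map f y - transpose_map f z"
  and transpose_scaleC: "transpose_map f (a *\<^sub>C y) = a *\<^sub>C transpose_map f y"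
  by (auto simp: transpose_map_def fun_eq_iff scaleC_fun_def)

lemma transpose_sum: "transpose_map f (\<Sum>i\<in>I. y i) = (\<Sum>i\<in>I. transpose_map f (y i))"
  by (induction I rule: infinite_finite_induct)
    (simp_all only: sum.infinite sum.empty sum.insert transpose_zero transpose_add not_False_eq_True)

lemma transpose_bounded_op:
  fixes f :: "'e::complex_normed_vector \<Rightarrow> 'f::complex_normed_vector"
  assumes "weight U v" "f \<in> vecs (Hv U v whole)"
  shows "bounded_op (dual whole) (Hvc U v) (transpose_map f)"
  unfolding bounded_op_def
  using nrm_transpose_le[OF assms] by (auto simp: transpose_add transpose_scaleC)

text \<open>A bounded linear operator preserves Frechet differentiability: if \<open>A\<close> is
  the derivative of \<open>g\<close>, then \<open>?S \<circ> A\<close> is that of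
  \<open>?S \<circ> g\<close>, with remainder enlarged at most by the factor \<open>?K\<close>. The
  weighted bound picks up the same factor.\<close>

lemma transpose_comp_mem_Hv:
  fixes f :: "'e::complex_normed_vector \<Rightarrow> 'f::complex_normed_vector"
  assumes v: "weight U v" and f: "f \<in> vecs (Hv U v whole)" and g: "g \<in> vecs (Hv U v (dual whole))"
  shows "transpose_map f \<circ> g \<in> vecs (Hv U v (Hvc U v))"
proof -
  let ?X = "dual whole :: ('f \<Rightarrow> complex) nspace" and ?Y = "Hvc U v" and ?S = "transpose_map f"
  let ?K = "nrm (Hv U v whole) f"
  note S = transpose_bounded_op[OF v f] and S_le = nrm_transpose_le(2)[OF v f]
  \<comment> \<open>Membership is needed at every point, since \<open>x + t\<close> in the
    difference quotient may leave \<open>U\<close>; there \<open>g\<close> is 0.\<close>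
  have g_mem: "g x \<in> vecs ?X" for x
    using g by (cases "x \<in> U") (auto simp: Hv_mem holomorphic_into_def dual_zero)
  have "holomorphic_into U ?Y (?S \<circ> g)"
    unfolding holomorphic_into_def
  proof (intro conjI ballI)
    fix x assume x: "x \<in> U"
    show "(?S \<circ> g) x \<in> vecs ?Y" using bounded_op_mem[OF S g_mem] by simp
    obtain A where A: "bounded_op whole ?X A"
      and lim: "((\<lambda>t. nrm ?X (g (x + t) - g x - A t) / norm t) \<longlongrightarrow> 0) (at 0)"
      using g x by (auto simp: Hv_mem holomorphic_into_def)
    obtain C where C: "\<And>t. nrm ?X (A t) \<le> C * norm t"
      using bounded_opE[OF A] by auto
    have A_mem: "A t \<in> vecs ?X" for t using A by (auto simp: bounded_op_def)
    have "nrm ?Y (?S (A t)) \<le> (?K * C) * norm t" for t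
      using S_le[OF A_mem[of t]] mult_left_mono[OF C[of t] nrm_Hv_nonneg[OF f]]
      by (simp add: algebra_simps)
    then have "bounded_op whole ?Y (?S \<circ> A)"
      using A bounded_op_mem[OF S A_mem]
      unfolding bounded_op_def by (auto simp: transpose_add transpose_scaleC)
    moreover have "((\<lambda>t. nrm ?Y ((?S \<circ> g) (x + t) - (?S \<circ> g) x - (?S \<circ> A) t) / norm t) \<longlongrightarrow> 0) (at 0)"
    proof (rule Lim_null_comparison)
      have mem: "g (x + t) - g x - A t \<in> vecs ?X" for t
        by (intro dual_diff g_mem A_mem)
      have eq: "(?S \<circ> g) (x + t) - (?S \<circ> g) x - (?S \<circ> A) t = ?S (g (x + t) - g x - A t)" for t
        by (simp add: transpose_diff)
      have "0 \<le> nrm ?Y (?S (g (x + t) - g x - A t))" for t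
        by (intro nrm_Hv_nonneg bounded_op_mem[OF S mem])
      then show "\<forall>\<^sub>F t in at 0. norm (nrm ?Y ((?S \<circ> g) (x + t) - (?S \<circ> g) x - (?S \<circ> A) t) / norm t)
          \<le> ?K * (nrm ?X (g (x + t) - g x - A t) / norm t)"
        unfolding eq using S_le[OF mem] by (intro always_eventually allI) (auto intro: divide_right_mono)
      show "((\<lambda>t. ?K * (nrm ?X (g (x + t) - g x - A t) / norm t)) \<longlongrightarrow> 0) (at 0)"
        using tendsto_mult_left[OF lim, of ?K] by simp
    qed
    ultimately show "\<exists>A. bounded_op whole ?Y A \<and>
        ((\<lambda>t. nrm ?Y ((?S \<circ> g) (x + t) - (?S \<circ> g) x - A t) / norm t) \<longlongrightarrow> 0) (at 0)"
      by blast
  qed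
  moreover have "v x * nrm ?Y ((?S \<circ> g) x) \<le> ?K * nrm (Hv U v ?X) g" if x: "x \<in> U" for x
  proof -
    have "v x * nrm ?Y (?S (g x)) \<le> v x * (?K * nrm ?X (g x))"
      using v x by (intro mult_left_mono S_le g_mem) (auto simp: weight_def less_imp_le)
    also have "\<dots> \<le> ?K * nrm (Hv U v ?X) g"
      using mult_left_mono[OF Hv_le_nrm[OF g x] nrm_Hv_nonneg[OF f]] by (simp add: algebra_simps)
    finally show ?thesis by simp
  qed
  ultimately show ?thesis
    using g by (auto simp: Hv_mem intro!: bdd_aboveI2)
qed

section \<open>Point evaluations and the linearization\<close>

lemma nrm_Gv_nonneg: "\<phi> \<in> vecs (Gv U v) \<Longrightarrow> 0 \<le> nrm (Gv U v) \<phi>"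
  unfolding Gv_def
  using nrm_dual_nonneg[of \<phi> "Hvc U v", OF _ nrm_Hv_nonneg] zero_in_ball_Hvc[of U v] by auto

lemma continuous_map_compact_open_eval:
  assumes "x \<in> U"
  shows "continuous_map (compact_open_topology U) euclidean (\<lambda>h. h x)"
proof -
  let ?B = "{{h::'a \<Rightarrow> complex. h ` K \<subseteq> V} |K V. compact K \<and> K \<subseteq> U \<and> open V}"
  have basis: "openin (compact_open_topology U) {h. h x \<in> V}" if "open V" for V
  proof -
    have "{h. h x \<in> V} = {h. h ` {x} \<subseteq> V}" by auto
    \<comment> \<open>Singletons are compact, so evaluation at \<open>x\<close> pulls open sets back
      to subbasic ones.\<close>
    also have "\<dots> \<in> ?B"
      using assms that by (intro CollectI exI[of _ "{x}"] exI[of _ V]) simp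
    finally show ?thesis
      unfolding compact_open_topology_def by (rule topology_generated_by_Basis)
  qed
  \<comment> \<open>The topspace of a generated topology is the union of its generators;
    \<open>V = UNIV\<close> already gives everything.\<close>
  have "topspace (compact_open_topology U) = UNIV"
    using openin_subset[OF basis[OF open_UNIV]] by auto
  then show ?thesis using basis by (auto simp: continuous_map)
qed

text \<open>The scalar \<open>c\<close> is kept general to cover both \<open>c = 1\<close>, where
  \<open>T\<close> is evaluated, and \<open>c = v x\<close>, which lands in the unit ball.\<close>

lemma scaleC_Delta_mem_Gv:
  assumes v: "weight U v" and x: "x \<in> U"
  shows "c *\<^sub>C Delta U v x \<in> vecs (Gv U v)"
proof -
  let ?Y = "Hvc U v"
  have vx: "0 < v x" using v x by (simp add: weight_def)
  \<comment> \<open>Positivity of the weight bounds the evaluation at \<open>x\<close> by the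
    constant \<open>inverse (v x)\<close>.\<close>
  have "cmod (h x) \<le> inverse (v x) * nrm ?Y h" if "h \<in> vecs ?Y" for h
    using Hv_le_nrm[OF that x] vx by (simp add: field_simps)
  then have "bounded_op ?Y whole (Delta U v x)"
    by (auto simp: bounded_op_def Delta_def Hvc_add[OF v] Hvc_scaleC
        intro!: exI[of _ "inverse (v x)"])
  then have "Delta U v x \<in> vecs (dual ?Y)"
    by (simp add: dual_def Delta_def)
  moreover have "continuous_map (subtopology (compact_open_topology U) (closed_unit_ball ?Y))
                 euclidean (c *\<^sub>C Delta U v x)"
  \<comment> \<open>On the unit ball the cut-off in \<open>Delta\<close> is invisible, so plain
    evaluation can replace it.\<close>
  proof (rule continuous_map_eq)
    have "continuous_map (compact_open_topology U) euclidean ((\<lambda>z. c * z) \<circ> (\<lambda>h. h x))"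
      by (intro continuous_map_compose[OF continuous_map_compact_open_eval[OF x]])
        (auto intro!: continuous_on_mult_left continuous_on_id)
    then show "continuous_map (subtopology (compact_open_topology U) (closed_unit_ball ?Y))
        euclidean ((\<lambda>z. c * z) \<circ> (\<lambda>h. h x))"
      by (rule continuous_map_from_subtopology)
  qed (auto simp: closed_unit_ball_def Delta_def scaleC_fun_def scaleC_complex_def)
  ultimately show ?thesis by (simp add: Gv_def dual_scaleC)
qed

lemma weighted_Delta_in_ball_Gv:
  assumes v: "weight U v" and x: "x \<in> U"
  shows "complex_of_real (v x) *\<^sub>C Delta U v x \<in> closed_unit_ball (Gv U v)"
proof -
  have vx: "0 < v x" using v x by (simp add: weight_def)
  have "cmod ((complex_of_real (v x) *\<^sub>C Delta U v x) h) \<le> 1" if "h \<in> closed_unit_ball (Hvc U v)" for h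
    using Hv_le_nrm[OF _ x, of h v whole] that vx
    by (auto simp: closed_unit_ball_def Delta_def scaleC_fun_def scaleC_complex_def norm_mult)
  then have "nrm (dual (Hvc U v)) (complex_of_real (v x) *\<^sub>C Delta U v x) \<le> 1"
    using zero_in_ball_Hvc by (intro nrm_dual_le) auto
  then show ?thesis
    using scaleC_Delta_mem_Gv[OF assms] by (simp add: closed_unit_ball_def Gv_def)
qed

text \<open>Bridges two norms: the summing hypothesis measures the adjoint in the dual of
  \<open>Gv U v\<close>, whereas the \<open>p\<close>-compact conclusion lives in
  \<open>Hvc U v\<close>.\<close>

lemma nrm_transpose_le_adjoint:
  fixes f :: "'e::complex_normed_vector \<Rightarrow> 'f::complex_normed_vector"
  assumes v: "weight U v" and T: "is_linearization U v f T"
    and y: "y \<in> vecs (dual whole)" and adj: "adjoint_op (Gv U v) T y \<in> vecs (dual (Gv U v))"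
  shows "nrm (Hvc U v) (transpose_map f y) \<le> nrm (dual (Gv U v)) (adjoint_op (Gv U v) T y)"
proof (rule nrm_Hv_le)
  \<comment> \<open>Over an empty ball the real supremum would be unspecified; the zero functional
    excludes this.\<close>
  have "closed_unit_ball (Gv U v) \<noteq> {}"
  proof -
    have "nrm (dual (Hvc U v)) 0 \<le> 0" using zero_in_ball_Hvc by (intro nrm_dual_le) auto
    moreover have "continuous_map X euclidean (0 :: ('e \<Rightarrow> complex) \<Rightarrow> complex)" for X
      by (simp add: zero_fun_def)
    ultimately have "0 \<in> closed_unit_ball (Gv U v)"
      by (simp add: closed_unit_ball_def Gv_def dual_zero)
    then show ?thesis by blast
  qed
  then show "0 \<le> nrm (dual (Gv U v)) (adjoint_op (Gv U v) T y)"
    by (intro nrm_dual_nonneg adj nrm_Gv_nonneg)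
  fix x assume x: "x \<in> U"
  let ?D = "complex_of_real (v x) *\<^sub>C Delta U v x"
  have Dx: "Delta U v x \<in> vecs (Gv U v)"
    using scaleC_Delta_mem_Gv[OF v x, of 1] by (simp add: scaleC_one)
  have "T ?D = complex_of_real (v x) *\<^sub>C f x"
    using T x bounded_op_scaleC[of "Gv U v" whole T, OF _ Dx] by (simp add: is_linearization_def)
  then have "adjoint_op (Gv U v) T y ?D = complex_of_real (v x) * y (f x)"
    using scaleC_Delta_mem_Gv[OF v x] bounded_op_scaleC[OF dual_bounded_op[OF y]]
    by (simp add: adjoint_op_def scaleC_complex_def)
  then have "v x * cmod (y (f x)) = cmod (adjoint_op (Gv U v) T y ?D)"
    using v x by (auto simp: norm_mult weight_def less_imp_le)
  also have "\<dots> \<le> nrm (dual (Gv U v)) (adjoint_op (Gv U v) T y)"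
    by (intro dual_le_nrm adj nrm_Gv_nonneg weighted_Delta_in_ball_Gv[OF v x])
  finally show "v x * nrm whole (transpose_map f y x)
      \<le> nrm (dual (Gv U v)) (adjoint_op (Gv U v) T y)"
    by (simp add: transpose_map_def)
qed

section \<open>Summing operators and p-compact sets\<close>

lemma zero_in_ball_dual:
  assumes "closed_unit_ball X \<noteq> {}"
  shows "0 \<in> closed_unit_ball (dual X)"
  using nrm_dual_le[OF assms, of 0 1] by (auto simp: closed_unit_ball_def dual_zero)

text \<open>The summing inequality concerns finite families. Their weak norm is at most that of the
  whole sequence, so all partial sums obey one bound. Only domination of \<open>z n\<close> by
  \<open>T (y n)\<close> is required, which lets \<open>z\<close> live in a different space
  \<open>Y\<close>.\<close>

lemma p_summing_lp:
  fixes y :: "nat \<Rightarrow> 'a::complex_vector"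
  assumes p: "1 \<le> p" and y: "y \<in> lpw_seqs X p" and C: "p_summing_bound X Z p T C"
    and ball: "closed_unit_ball X \<noteq> {}"
    and z: "\<And>n. z n \<in> vecs Y" "\<And>n. 0 \<le> nrm Y (z n)" "\<And>n. nrm Y (z n) \<le> nrm Z (T (y n))"
  shows "z \<in> lp_seqs Y p" "lp_norm Y p z \<le> C * lpw_norm X p y"
proof -
  let ?W = "lpw_norm X p y" and ?B = "closed_unit_ball (dual X)"
  have C0: "0 \<le> C" using C by (simp add: p_summing_bound_def)
  have sm: "\<And>\<phi>. \<phi> \<in> ?B \<Longrightarrow> summable (\<lambda>n. cmod (\<phi> (y n)) powr p)"
    and bdd: "bdd_above ((\<lambda>\<phi>. (\<Sum>n. cmod (\<phi> (y n)) powr p) powr (1 / p)) ` ?B)"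
    and yX: "\<And>n. y n \<in> vecs X"
    using y by (auto simp: lpw_seqs_def)
  have fin: "(\<Sum>i<n. nrm Y (z i) powr p) powr (1 / p) \<le> C * ?W" for n
  proof -
    have "(\<Sum>i<n. nrm Y (z i) powr p) powr (1 / p) \<le> (\<Sum>i<n. nrm Z (T (y i)) powr p) powr (1 / p)"
      using z p by (intro powr_mono2 sum_mono sum_nonneg) auto
    also have "\<dots> \<le> C * (SUP \<phi>\<in>?B. (\<Sum>i<n. cmod (\<phi> (y i)) powr p) powr (1 / p))"
      using C yX by (simp add: p_summing_bound_def)
    also have "\<dots> \<le> C * ?W"
      unfolding lpw_norm_def
    proof (intro mult_left_mono C0 cSUP_mono bdd)
      show "?B \<noteq> {}" using zero_in_ball_dual[OF ball] by blast
      show "\<exists>m\<in>?B. (\<Sum>i<n. cmod (\<phi> (y i)) powr p) powr (1 / p)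
          \<le> (\<Sum>n. cmod (m (y n)) powr p) powr (1 / p)" if "\<phi> \<in> ?B" for \<phi>
        using p sm[OF that] that by (intro bexI[of _ \<phi>] powr_mono2 sum_le_suminf sum_nonneg) auto
    qed
    finally show ?thesis .
  qed
  \<comment> \<open>The empty partial sum gives the sign needed to cancel the exponents
    \<open>p\<close> and \<open>1 / p\<close> at the end.\<close>
  have W0: "0 \<le> C * ?W" using fin[of 0] p by simp
  have fin': "(\<Sum>i<n. nrm Y (z i) powr p) \<le> (C * ?W) powr p" for n
    using powr_mono2[OF _ _ fin[of n], of p] p
    by (simp add: powr_powr sum_nonneg)
  \<comment> \<open>\<open>bounded_imp_summable\<close> sums over \<open>{..n}\<close>, so the bound
    on sums below \<open>Suc n\<close> is used.\<close>
  have sz: "summable (\<lambda>n. nrm Y (z n) powr p)"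
    using fin' by (intro bounded_imp_summable[where B = "(C * ?W) powr p"])
      (auto simp: lessThan_Suc_atMost[symmetric] simp del: sum.lessThan_Suc)
  then show "z \<in> lp_seqs Y p" using z by (simp add: lp_seqs_def)
  have "lp_norm Y p z \<le> ((C * ?W) powr p) powr (1 / p)"
    unfolding lp_norm_def using p sz fin'
    by (intro powr_mono2 suminf_le_const suminf_nonneg) auto
  then show "lp_norm Y p z \<le> C * ?W" using p W0 by (simp add: powr_powr)
qed

text \<open>The same coefficients serve: the transpose commutes with finite combinations, and its
  boundedness carries the norm convergence over.\<close>

lemma transpose_p_conv:
  fixes f :: "'e::complex_normed_vector \<Rightarrow> 'f::complex_normed_vector"
  assumes v: "weight U v" and f: "f \<in> vecs (Hv U v whole)"
    and y: "\<And>n. y n \<in> vecs (dual whole)" and w: "w \<in> p_conv (dual whole) p y"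
  shows "transpose_map f w \<in> p_conv (Hvc U v) p (\<lambda>n. transpose_map f (y n))"
proof -
  let ?S = "transpose_map f"
  note S = transpose_bounded_op[OF v f]
  obtain a where a: "a \<in> coeff_ball p" and wX: "w \<in> vecs (dual whole)"
    and lim: "(\<lambda>N. nrm (dual whole) ((\<Sum>n<N. a n *\<^sub>C y n) - w)) \<longlonglongrightarrow> 0"
    using w by (auto simp: p_conv_def)
  have mem: "(\<Sum>n<N. a n *\<^sub>C y n) - w \<in> vecs (dual whole)" for N
    by (intro dual_diff dual_sum dual_scaleC y wX) simp
  have eq: "(\<Sum>n<N. a n *\<^sub>C ?S (y n)) - ?S w = ?S ((\<Sum>n<N. a n *\<^sub>C y n) - w)" for N
    by (simp add: transpose_diff transpose_sum transpose_scaleC)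
  have "(\<lambda>N. nrm (Hvc U v) ((\<Sum>n<N. a n *\<^sub>C ?S (y n)) - ?S w)) \<longlonglongrightarrow> 0"
    unfolding eq
  proof (rule Lim_null_comparison)
    have "0 \<le> nrm (Hvc U v) (?S ((\<Sum>n<N. a n *\<^sub>C y n) - w))" for N
      by (intro nrm_Hv_nonneg bounded_op_mem[OF S mem])
    then show "\<forall>\<^sub>F N in sequentially. norm (nrm (Hvc U v) (?S ((\<Sum>n<N. a n *\<^sub>C y n) - w)))
        \<le> nrm (Hv U v whole) f * nrm (dual whole) ((\<Sum>n<N. a n *\<^sub>C y n) - w)"
      using nrm_transpose_le(2)[OF v f mem] by (intro always_eventually allI) simp
    show "(\<lambda>N. nrm (Hv U v whole) f * nrm (dual whole) ((\<Sum>n<N. a n *\<^sub>C y n) - w)) \<longlonglongrightarrow> 0"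
      using tendsto_mult_left[OF lim] by simp
  qed
  then show ?thesis
    using a bounded_op_mem[OF S wX] by (auto simp: p_conv_def)
qed

section \<open>Passage to the infima defining \<open>pi_norm\<close>, \<open>m_Kwp\<close> and
  \<open>m_Kp\<close>\<close>

theorem proposition2p18:
  fixes U :: "'e::complex_banach set"
    and v :: "'e \<Rightarrow> real"
    and p :: real
    and f :: "'e \<Rightarrow> 'f::complex_banach"
    and g :: "'e \<Rightarrow> 'f \<Rightarrow> complex"
    and T\<^sub>f :: "(('e \<Rightarrow> complex) \<Rightarrow> complex) \<Rightarrow> 'f"
  assumes "open U"
    and "weight U v"
    and "1 \<le> p"
    and "f \<in> vecs (Hv U v whole)"
    and "g \<in> vecs (Hv_Kwp U v (dual whole) p)"
    and "is_linearization U v f T\<^sub>f"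
    and "adjoint_op (Gv U v) T\<^sub>f \<in> p_summing_ops (dual whole) (dual (Gv U v)) p"
  shows "transpose_map f \<circ> g \<in> vecs (Hv_Kp U v (Hvc U v) p) \<and>
         nrm (Hv_Kp U v (Hvc U v) p) (transpose_map f \<circ> g)
         \<le> pi_norm (dual whole) (dual (Gv U v)) p (adjoint_op (Gv U v) T\<^sub>f)
           * nrm (Hv_Kwp U v (dual whole) p) g"
proof -
  let ?X = "dual whole :: ('f \<Rightarrow> complex) nspace" and ?Y = "Hvc U v" and ?Z = "dual (Gv U v)"
  let ?T = "adjoint_op (Gv U v) T\<^sub>f" and ?S = "transpose_map f"
  let ?R = "weighted_range U v g" and ?Q = "weighted_range U v (?S \<circ> g)"
  note v = assms(2) and p = assms(3) and f = assms(4)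
  have g: "g \<in> vecs (Hv U v ?X)" and g_wc: "rel_weakly_p_compact ?X p ?R"
    using assms(5) by (auto simp: Hv_Kwp_def)
  define Cs where "Cs = {C. p_summing_bound ?X ?Z p ?T C}"
  have T: "bounded_op ?X ?Z ?T" and Cs: "Cs \<noteq> {}"
    using assms(7) unfolding p_summing_ops_def Cs_def by blast+
  have pi: "pi_norm ?X ?Z p ?T = Inf Cs" by (simp add: pi_norm_def Cs_def)
  have pi_nonneg: "0 \<le> Inf Cs"
    by (intro cInf_greatest[OF Cs]) (simp add: Cs_def p_summing_bound_def)
  have ballX: "closed_unit_ball ?X \<noteq> {}"
    using zero_in_ball_dual[of "whole :: 'f nspace"] by (force simp: closed_unit_ball_def intro: exI[of _ 0])
  \<comment> \<open>The factor \<open>v x\<close> passes through \<open>?S\<close> by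
    homogeneity.\<close>
  have Q: "?Q = ?S ` ?R" by (auto simp: weighted_range_def transpose_scaleC image_image)
  \<comment> \<open>With \<open>y\<close> fixed, only the infimum over the summing constants is
    taken; the infimum over \<open>y\<close> follows afterwards.\<close>
  have main: "(\<lambda>n. ?S (y n)) \<in> lp_seqs ?Y p \<and> ?Q \<subseteq> p_conv ?Y p (\<lambda>n. ?S (y n)) \<and>
      lp_norm ?Y p (\<lambda>n. ?S (y n)) \<le> Inf Cs * lpw_norm ?X p y"
    if y: "y \<in> lpw_seqs ?X p" and R: "?R \<subseteq> p_conv ?X p y" for y
  proof -
    let ?z = "\<lambda>n. ?S (y n)"
    have yX: "y n \<in> vecs ?X" for n using y by (auto simp: lpw_seqs_def)
    have zY: "?z n \<in> vecs ?Y" for n by (intro nrm_transpose_le(1)[OF v f] yX)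
    have z_le: "nrm ?Y (?z n) \<le> nrm ?Z (?T (y n))" for n
      by (intro nrm_transpose_le_adjoint[OF v assms(6)] yX bounded_op_mem[OF T])
    \<comment> \<open>The premise on the constant stays open, so that every
      \<open>C \<in> Cs\<close> can be inserted.\<close>
    note lp = p_summing_lp[where T = ?T and Z = ?Z and z = ?z and Y = ?Y,
        OF p y _ ballX zY nrm_Hv_nonneg[OF zY] z_le]
    have le: "lp_norm ?Y p ?z \<le> C * lpw_norm ?X p y" if "C \<in> Cs" for C
      using lp(2) that by (simp add: Cs_def)
    obtain C where C: "C \<in> Cs" using Cs by blast
    have W0: "0 \<le> lpw_norm ?X p y"
    proof -
      \<comment> \<open>Testing the supremum with the zero functional shows its sign.\<close>
      have "(\<Sum>n. cmod (0 (y n)) powr p) powr (1 / p) \<le> lpw_norm ?X p y"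
        unfolding lpw_norm_def
        by (rule cSUP_upper2[OF _ zero_in_ball_dual[OF ballX] order_refl])
          (use y in \<open>simp add: lpw_seqs_def\<close>)
      then show ?thesis by (auto intro: order_trans[OF powr_ge_zero])
    qed
    have "lp_norm ?Y p ?z \<le> Inf Cs * lpw_norm ?X p y"
    \<comment> \<open>The infimum is reached by dividing by the weak norm. If that is 0, any single
      \<open>C\<close> already gives the bound 0.\<close>
    proof (cases "lpw_norm ?X p y = 0")
      case True
      then show ?thesis using le[OF C] by simp
    next
      case False
      then have "lp_norm ?Y p ?z / lpw_norm ?X p y \<le> Inf Cs"
        using le W0 Cs by (intro cInf_greatest) (auto simp: field_simps)
      then show ?thesis using False W0 by (simp add: field_simps)
    qed
    moreover have "?Q \<subseteq> p_conv ?Y p ?z"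
      unfolding Q using R by (auto intro!: transpose_p_conv[OF v f yX])
    ultimately show ?thesis using lp(1)[of C] C unfolding Cs_def by blast
  qed
  have "rel_p_compact ?Y p ?Q"
    using g_wc main unfolding rel_p_compact_def rel_weakly_p_compact_def by blast
  then have mem: "?S \<circ> g \<in> vecs (Hv_Kp U v ?Y p)"
    using transpose_comp_mem_Hv[OF v f g] by (simp add: Hv_Kp_def)
  define L where "L = {lpw_norm ?X p y | y. y \<in> lpw_seqs ?X p \<and> ?R \<subseteq> p_conv ?X p y}"
  have L: "L \<noteq> {}" using g_wc by (auto simp: L_def rel_weakly_p_compact_def)
  have m_le: "m_Kp ?Y p ?Q \<le> Inf Cs * l" if "l \<in> L" for l
  proof -
    obtain y where y: "y \<in> lpw_seqs ?X p" "?R \<subseteq> p_conv ?X p y" "l = lpw_norm ?X p y"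
      using \<open>l \<in> L\<close> unfolding L_def by blast
    have "m_Kp ?Y p ?Q \<le> lp_norm ?Y p (\<lambda>n. ?S (y n))"
      unfolding m_Kp_def
    proof (rule cInf_lower)
      show "bdd_below {lp_norm ?Y p x |x. x \<in> lp_seqs ?Y p \<and> ?Q \<subseteq> p_conv ?Y p x}"
        by (rule bdd_belowI[of _ 0]) (auto simp: lp_norm_def)
    qed (use main[OF y(1,2)] in blast)
    then show ?thesis using main[OF y(1,2)] y(3) by simp
  qed
  have "m_Kp ?Y p ?Q \<le> Inf Cs * Inf L"
  \<comment> \<open>Division by \<open>Inf Cs\<close> moves the bound to \<open>Inf L\<close>; when
    \<open>Inf Cs\<close> is 0, one element of \<open>L\<close> suffices.\<close>
  proof (cases "Inf Cs = 0")
    case True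
    then show ?thesis using L m_le by auto
  next
    case False
    then have "m_Kp ?Y p ?Q / Inf Cs \<le> Inf L"
      using m_le pi_nonneg L by (intro cInf_greatest) (auto simp: field_simps)
    then show ?thesis using False pi_nonneg by (simp add: field_simps)
  qed
  moreover have "m_Kwp ?X p ?R = Inf L" by (simp add: m_Kwp_def L_def)
  ultimately show ?thesis using mem by (simp add: Hv_Kp_def Hv_Kwp_def pi)
qed

end
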